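(* Let $p_B\in(0,1]$, let $(X_n)_{n\ge0}$ be the two-armed bandit algorithm with parameters $p_A,p_B$ and step sequence $(\gamma_n)_{n\ge1}$ (defined in the context), and let $X_\infty$ be the a.s. limit of $X_n$. (a) Constant step. If $\gamma_n=\gamma\in(0,1)$ for all $n\ge1$, then the algorithm converges toward $0$ with positive probability; namely $$\forall x\in(0,1),\qquad \mathbb{P}_x(X_\infty=0)\ge(1-x)^{1/(p_B\gamma)}>0.$$ (b) Power step. Let $\gamma_n=\left(\frac{C}{n+C}\right)^\alpha$, $n\ge1$, with $0<\alpha\le1$ and $C>0$; these steps satisfy $\gamma_n\in(0,1)$ and $\sum_n\gamma_n=+\infty$. If either $0<\alpha<1$, or $\alpha=1$ and $C>1/p_B$, then $\mathbb{P}_x(X_\infty=0)>0$ for every $x\in[0,1)$. (c) In particular, if $0<p_B<p_A\le1$, the two-armed bandit algorithm is fallible starting from any $x\in[0,1)$, i.e. $\mathbb{P}_x(X_n\to0)>0$, for the step sequences specified in (a) and for those in (b) with ($0<\alpha<1$) or ($\alpha=1$ and $C>1/p_B$).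
   Context: Two-armed bandit algorithm: let $(U_n)_{n\ge1}$ be i.i.d. random variables uniformly distributed on $[0,1]$, and let $(A_n)_{n\ge1},(B_n)_{n\ge1}$ be events such that $(\mathbf 1_{A_n},\mathbf 1_{B_n})_{n\ge1}$ is an i.i.d. sequence, independent of $(U_n)_{n\ge1}$, with $\mathbb{P}(A_1)=p_A\in[0,1]$ and $\mathbb{P}(B_1)=p_B\in[0,1]$. The steps satisfy $\gamma_n\in(0,1)$ for all $n\ge1$ and $\sum_n\gamma_n=+\infty$. The algorithm starting from $x\in[0,1]$ is defined by $X_0=x$ and, for $n\ge0$, $$X_{n+1}=X_n+\gamma_{n+1}\big((1-X_n)\mathbf 1_{\{U_{n+1}\le X_n\}\cap A_{n+1}}-X_n\mathbf 1_{\{U_{n+1}>X_n\}\cap B_{n+1}}\big).$$ $\mathbb{P}_x$ denotes probability when $X_0=x$. The a.s. limit $X_\infty=\lim_nX_n$ always exists, since $(X_n)$ is $[0,1]$-valued and a submartingale or supermartingale according to the sign of $p_A-p_B$. *)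

theory Defs
  imports "HOL-Probability.Probability"
begin

text \<open>All driving sequences are indexed by \<open>n \<ge> 1\<close>; their values at \<open>0\<close> are unconstrained and unused.
  Within one pair, the indicators of \<open>A n\<close> and \<open>B n\<close> may be dependent.
  Independence of the two sequences is that of the \<open>\<sigma>\<close>-algebras they generate, because
  \<open>indep_var\<close> requires both variables to have the same value type.\<close>

locale bandit_driver = prob_space M for M :: "'a measure" +
  fixes U :: "nat \<Rightarrow> 'a \<Rightarrow> real" and A B :: "nat \<Rightarrow> 'a set" and pA pB :: real
  assumes U_indep: "indep_vars (\<lambda>_. borel) U {1..}"
    and U_uniform: "\<And>n. n \<ge> 1 \<Longrightarrow> distr M borel (U n) = uniform_measure lborel {0..1}"
    and A_events: "\<And>n. n \<ge> 1 \<Longrightarrow> A n \<in> events"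
    and B_events: "\<And>n. n \<ge> 1 \<Longrightarrow> B n \<in> events"
    and AB_indep: "indep_vars (\<lambda>_. borel \<Otimes>\<^sub>M borel)
      (\<lambda>n \<omega>. (indicator (A n) \<omega> :: real, indicator (B n) \<omega> :: real)) {1..}"
    and AB_identical: "\<And>n. n \<ge> 1 \<Longrightarrow>
      distr M (borel \<Otimes>\<^sub>M borel) (\<lambda>\<omega>. (indicator (A n) \<omega> :: real, indicator (B n) \<omega> :: real)) =
      distr M (borel \<Otimes>\<^sub>M borel) (\<lambda>\<omega>. (indicator (A 1) \<omega> :: real, indicator (B 1) \<omega> :: real))"
    and U_AB_indep: "indep_set
      (sets (vimage_algebra (space M) (\<lambda>\<omega>. \<lambda>n\<in>{1..}. U n \<omega>) (PiM {1..} (\<lambda>_. borel))))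
      (sets (vimage_algebra (space M)
        (\<lambda>\<omega>. \<lambda>n\<in>{1..}. (indicator (A n) \<omega> :: real, indicator (B n) \<omega> :: real))
        (PiM {1..} (\<lambda>_. borel \<Otimes>\<^sub>M borel))))"
    and prob_A: "prob (A 1) = pA"
    and prob_B: "prob (B 1) = pB"

definition bandit_steps :: "(nat \<Rightarrow> real) \<Rightarrow> bool" where
  "bandit_steps \<gamma> \<longleftrightarrow> (\<forall>n\<ge>1. 0 < \<gamma> n \<and> \<gamma> n < 1) \<and>
     filterlim (\<lambda>N. \<Sum>n=1..N. \<gamma> n) at_top sequentially"

primrec bandit ::
  "(nat \<Rightarrow> 'a \<Rightarrow> real) \<Rightarrow> (nat \<Rightarrow> 'a set) \<Rightarrow> (nat \<Rightarrow> 'a set) \<Rightarrow> (nat \<Rightarrow> real) \<Rightarrow> real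
    \<Rightarrow> nat \<Rightarrow> 'a \<Rightarrow> real" where
  "bandit U A B \<gamma> x 0 \<omega> = x"
| "bandit U A B \<gamma> x (Suc n) \<omega> =
     (let X = bandit U A B \<gamma> x n \<omega> in
      X + \<gamma> (Suc n) * ((1 - X) * indicator ({\<omega>'. U (Suc n) \<omega>' \<le> X} \<inter> A (Suc n)) \<omega>
                     - X * indicator ({\<omega>'. U (Suc n) \<omega>' > X} \<inter> B (Suc n)) \<omega>))"

definition bandit_limit ::
  "(nat \<Rightarrow> 'a \<Rightarrow> real) \<Rightarrow> (nat \<Rightarrow> 'a set) \<Rightarrow> (nat \<Rightarrow> 'a set) \<Rightarrow> (nat \<Rightarrow> real) \<Rightarrow> real
    \<Rightarrow> 'a \<Rightarrow> real" where
  "bandit_limit U A B \<gamma> x \<omega> = lim (\<lambda>n. bandit U A B \<gamma> x n \<omega>)"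

text \<open>Since \<open>lim\<close> is unspecified on divergent sequences, the event that the almost sure limit
  vanishes is taken within the set of convergence, which has probability one. It is thus almost
  surely the event \<open>X\<^sub>\<infinity> = 0\<close> for every version \<open>X\<^sub>\<infinity>\<close> of the almost sure limit.\<close>

definition limit_zero_prob ::
  "'a measure \<Rightarrow> (nat \<Rightarrow> 'a \<Rightarrow> real) \<Rightarrow> (nat \<Rightarrow> 'a set) \<Rightarrow> (nat \<Rightarrow> 'a set) \<Rightarrow> (nat \<Rightarrow> real) \<Rightarrow> real
    \<Rightarrow> real" where
  "limit_zero_prob M U A B \<gamma> x =
     measure M {\<omega> \<in> space M. convergent (\<lambda>n. bandit U A B \<gamma> x n \<omega>) \<and> bandit_limit U A B \<gamma> x \<omega> = 0}"

definition fallible_from ::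
  "'a measure \<Rightarrow> (nat \<Rightarrow> 'a \<Rightarrow> real) \<Rightarrow> (nat \<Rightarrow> 'a set) \<Rightarrow> (nat \<Rightarrow> 'a set) \<Rightarrow> (nat \<Rightarrow> real) \<Rightarrow> real
    \<Rightarrow> bool" where
  "fallible_from M U A B \<gamma> x \<longleftrightarrow>
     measure M {\<omega> \<in> space M. (\<lambda>n. bandit U A B \<gamma> x n \<omega>) \<longlonglongrightarrow> 0} > 0"

definition power_step :: "real \<Rightarrow> real \<Rightarrow> nat \<Rightarrow> real" where
  "power_step C \<alpha> n = (C / (real n + C)) powr \<alpha>"

end

theory Submission
  imports Defs "HOL-Real_Asymp.Real_Asymp"
begin

text \<open>As long as \<open>U\<^sub>k\<close> exceeds the current value at every step \<open>k\<close>, the algorithm only moves downwards: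
  \<open>X\<^sub>n = x Y\<^sub>n\<close> with \<open>Y\<^sub>n = \<Prod>k\<le>n. (1 - \<gamma>\<^sub>k 1\<^bsub>B\<^sub>k\<^esub>)\<close>, a product that does not involve \<open>U\<close>. Let
  \<open>P\<^sub>n = E Y\<^sub>n = \<Prod>k\<le>n. (1 - p\<^sub>B \<gamma>\<^sub>k)\<close> and suppose \<open>S = (\<Sum>n\<ge>0. P\<^sub>n)\<close> is finite. Then \<open>Y\<^sub>n \<rightarrow> 0\<close> almost
  surely, so it suffices to bound below the probability of the survival events
  \<open>E\<^sub>n = {U\<^sub>k > x Y\<^sub>k\<^sub>-\<^sub>1 for all k \<le> n}\<close>. With \<open>T\<^sub>n = (\<Sum>m\<ge>n. P\<^sub>m) / P\<^sub>n\<close>, the expectation of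
  \<open>1\<^bsub>E\<^sub>n\<^esub> (1 - x Y\<^sub>n)\<close> to the power \<open>T\<^sub>n\<close> is nondecreasing in \<open>n\<close>, whence \<open>P(E\<^sub>n) \<ge> (1 - x)\<close> to the
  power \<open>S\<close>.\<close>

section \<open>Products of step factors and their means\<close>

text \<open>Randomness enters only through the set \<open>s\<close> of times at which
  \<open>B\<close> occurs, so that one function serves both a fixed pattern in a finite sum and the
  random set of a sample point.\<close>

definition decay :: "(nat \<Rightarrow> real) \<Rightarrow> nat set \<Rightarrow> nat \<Rightarrow> real" where
  "decay \<gamma> s n = (\<Prod>k=1..n. 1 - \<gamma> k * indicator s k)"

definition mean_decay :: "(nat \<Rightarrow> real) \<Rightarrow> real \<Rightarrow> nat \<Rightarrow> real" where
  "mean_decay \<gamma> p n = (\<Prod>k=1..n. 1 - p * \<gamma> k)"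

lemma decay_0 [simp]: "decay \<gamma> s 0 = 1"
  by (simp add: decay_def)

lemma decay_Suc: "decay \<gamma> s (Suc n) = decay \<gamma> s n * (1 - \<gamma> (Suc n) * indicator s (Suc n))"
  by (simp add: decay_def)

lemma mean_decay_0 [simp]: "mean_decay \<gamma> p 0 = 1"
  by (simp add: mean_decay_def)

lemma mean_decay_Suc: "mean_decay \<gamma> p (Suc n) = mean_decay \<gamma> p n * (1 - p * \<gamma> (Suc n))"
  by (simp add: mean_decay_def)

lemma decay_cong:
  assumes "\<And>k. 1 \<le> k \<Longrightarrow> k \<le> n \<Longrightarrow> k \<in> s \<longleftrightarrow> k \<in> t"
  shows "decay \<gamma> s n = decay \<gamma> t n"
  unfolding decay_def using assms by (intro prod.cong) (auto simp: indicator_def)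

lemma decay_bounds:
  assumes "\<And>k. 1 \<le> k \<Longrightarrow> 0 < \<gamma> k \<and> \<gamma> k < 1"
  shows "0 \<le> decay \<gamma> s n" "decay \<gamma> s n \<le> 1"
  unfolding decay_def using assms
  by (auto intro!: prod_nonneg prod_le_1 simp: indicator_def less_imp_le)

lemma mean_decay_pos:
  assumes "\<And>k. 1 \<le> k \<Longrightarrow> 0 < \<gamma> k \<and> \<gamma> k < 1" and "0 \<le> p" "p \<le> 1"
  shows "0 < mean_decay \<gamma> p n"
proof -
  have "p * \<gamma> k < 1" if "1 \<le> k" for k
    using assms(1)[OF that] assms(2,3) mult_left_le_one_le[of "\<gamma> k" p] by linarith
  then show ?thesis unfolding mean_decay_def by (intro prod_pos) auto
qed

lemma decay_decseq:
  assumes "\<And>k. 1 \<le> k \<Longrightarrow> 0 < \<gamma> k \<and> \<gamma> k < 1"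
  shows "decseq (decay \<gamma> s)"
  unfolding decseq_Suc_iff decay_Suc
proof
  fix n
  show "decay \<gamma> s n * (1 - \<gamma> (Suc n) * indicator s (Suc n)) \<le> decay \<gamma> s n"
    using decay_bounds(1)[OF assms, where s=s and n=n] assms[of "Suc n"]
    by (intro mult_right_le_one_le) (auto simp: indicator_def less_imp_le)
qed

section \<open>One-step inequality and lower bound for the pattern sums\<close>

text \<open>This is the induction step of the survival bound. From the value \<open>c\<close>, the
  factor \<open>1 - c\<close> is the chance that the uniform variable exceeds \<open>c\<close>; the
  value then becomes \<open>c * (1 - g)\<close> with probability \<open>p\<close> and stays
  \<open>c\<close> otherwise. Both estimates are weighted AM-GM.\<close>

lemma bernoulli_step_lower_bound:
  fixes c g p t :: real
  assumes "0 \<le> c" "c < 1" "0 < g" "g < 1" "0 \<le> p" "p \<le> 1" "0 \<le> t"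
  shows "(1 - c) powr (1 + (1 - p * g) * t)
    \<le> (1 - c) * (p * (1 - c * (1 - g)) powr t + (1 - p) * (1 - c) powr t)"
proof -
  \<comment> \<open>AM-GM for the numbers \<open>1 - c\<close> and \<open>1\<close> with weights
    \<open>1 - g\<close> and \<open>g\<close>.\<close>
  have "(1 - c) powr (1 - g) * 1 powr g \<le> (1 - g) * (1 - c) + g * 1"
    using assms by (intro Youngs_inequality_0) auto
  then have base: "(1 - c) powr (1 - g) \<le> 1 - c * (1 - g)"
    by (simp add: algebra_simps)
  have "(1 - c) powr ((1 - g) * t) = ((1 - c) powr (1 - g)) powr t"
    by (simp add: powr_powr)
  also have "\<dots> \<le> (1 - c * (1 - g)) powr t"
    using base assms by (intro powr_mono2) auto
  finally have 1: "(1 - c) powr ((1 - g) * t) \<le> (1 - c * (1 - g)) powr t" .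
  \<comment> \<open>The exponent is the mean of \<open>(1 - g) * t\<close> and \<open>t\<close> with
    weights \<open>p\<close> and \<open>1 - p\<close>, so AM-GM applies again with these
    weights.\<close>
  have "(1 - c) powr ((1 - p * g) * t)
      = ((1 - c) powr ((1 - g) * t)) powr p * ((1 - c) powr t) powr (1 - p)"
    by (simp add: powr_powr powr_add[symmetric] algebra_simps)
  also have "\<dots> \<le> p * (1 - c) powr ((1 - g) * t) + (1 - p) * (1 - c) powr t"
    using assms by (intro Youngs_inequality_0) auto
  also have "\<dots> \<le> p * (1 - c * (1 - g)) powr t + (1 - p) * (1 - c) powr t"
    using 1 assms by (intro add_mono mult_left_mono) auto
  finally have "(1 - c) * (1 - c) powr ((1 - p * g) * t)
      \<le> (1 - c) * (p * (1 - c * (1 - g)) powr t + (1 - p) * (1 - c) powr t)"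
    using assms by (intro mult_left_mono) auto
  then show ?thesis using assms by (simp add: powr_add)
qed

text \<open>Each subset avoiding \<open>a\<close> is paired with the one obtained by adding
  \<open>a\<close>. In the induction on \<open>n\<close> these are the two continuations of a
  pattern.\<close>

lemma sum_Pow_insert:
  assumes "finite I" "a \<notin> I"
  shows "(\<Sum>s\<in>Pow (insert a I). f s) = (\<Sum>s\<in>Pow I. f s + f (insert a s))"
proof -
  have "inj_on (insert a) (Pow I)"
    using assms by (auto simp: inj_on_def)
  moreover have "Pow I \<inter> insert a ` Pow I = {}"
    using assms by auto
  ultimately show ?thesis
    using assms by (simp add: Pow_insert sum.union_disjoint sum.reindex sum.distrib)
qed

text \<open>The sum is \<open>P(E\<^sub>n)\<close> decomposed along the set \<open>s\<close> of indices \<open>k \<le> n\<close> at which \<open>B\<^sub>k\<close> occurs.\<close>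

lemma sum_pattern_lower_bound:
  fixes \<gamma> :: "nat \<Rightarrow> real" and p x :: real
  assumes \<gamma>: "\<And>k. 1 \<le> k \<Longrightarrow> 0 < \<gamma> k \<and> \<gamma> k < 1" and p: "0 \<le> p" "p \<le> 1"
    and x: "0 \<le> x" "x < 1" and summ: "summable (mean_decay \<gamma> p)"
  shows "(1 - x) powr (\<Sum>m. mean_decay \<gamma> p m)
    \<le> (\<Sum>s\<in>Pow {1..n}. \<Prod>k=1..n. (if k \<in> s then p else 1 - p) * (1 - x * decay \<gamma> s (k - 1)))"
proof -
  let ?P = "mean_decay \<gamma> p"
  define T where "T n = (\<Sum>m. ?P (m + n)) / ?P n" for n
  define w where "w s n = (\<Prod>k=1..n. (if k \<in> s then p else 1 - p) * (1 - x * decay \<gamma> s (k - 1)))" for s n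
  define y where "y s n = x * decay \<gamma> s n" for s n
  note Ppos = mean_decay_pos[of \<gamma> p, OF \<gamma> p, simplified]
  have tail: "summable (\<lambda>m. ?P (m + n))" for n
    using summ by (simp add: summable_iff_shift)
  have T0: "0 \<le> T n" for n
    unfolding T_def using Ppos by (intro divide_nonneg_pos suminf_nonneg tail) (auto intro: less_imp_le)
  \<comment> \<open>Splitting off the first term of the tail yields exactly the exponent of
    \<open>bernoulli_step_lower_bound\<close> with \<open>t = T (Suc n)\<close>; this dictates the
    choice of \<open>T\<close>.\<close>
  have TSuc: "T n = 1 + (1 - p * \<gamma> (Suc n)) * T (Suc n)" for n
  proof -
    have "(\<Sum>m. ?P (m + n)) = ?P n + (\<Sum>m. ?P (m + Suc n))"
      using suminf_split_head[OF tail[of n]] by simp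
    moreover have "T (Suc n) * ?P (Suc n) = (\<Sum>m. ?P (m + Suc n))"
      unfolding T_def using Ppos[of "Suc n"] by simp
    ultimately show ?thesis
      using Ppos[of n] by (simp add: T_def[of n] mean_decay_Suc field_simps)
  qed
  have y: "0 \<le> y s n" "y s n < 1" for s n
  proof -
    note d = decay_bounds[of \<gamma> s n, OF \<gamma>, simplified]
    show "0 \<le> y s n" unfolding y_def using d x by simp
    have "y s n \<le> x" unfolding y_def using d x by (intro mult_right_le_one_le) auto
    then show "y s n < 1" using x by simp
  qed
  have w0: "0 \<le> w s n" for s n
    unfolding w_def using y p by (intro prod_nonneg) (auto simp: y_def less_imp_le)
  \<comment> \<open>\<open>w s n\<close> is the weight of survival with pattern \<open>s\<close>,
    and \<open>y s n\<close> the value reached. Since \<open>mean_decay\<close> starts at 1,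
    \<open>T 0\<close> is the whole series.\<close>
  have "(1 - x) powr T 0 \<le> (\<Sum>s\<in>Pow {1..n}. w s n * (1 - y s n) powr T n)" for n
  proof (induction n)
    case 0
    then show ?case by (simp add: w_def y_def)
  next
    case (Suc n)
    have step: "w s n * (1 - y s n) powr T n
        \<le> w s (Suc n) * (1 - y s (Suc n)) powr T (Suc n)
          + w (insert (Suc n) s) (Suc n) * (1 - y (insert (Suc n) s) (Suc n)) powr T (Suc n)"
      if s: "s \<in> Pow {1..n}" for s
    proof -
      let ?s = "insert (Suc n) s"
      \<comment> \<open>The factors of \<open>w\<close> up to index \<open>n + 1\<close> use
        \<open>decay\<close> only up to \<open>n\<close>, so adding \<open>Suc n\<close> to the
        pattern changes no threshold.\<close>
      have d: "decay \<gamma> ?s k = decay \<gamma> s k" if "k \<le> n" for k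
        using that by (intro decay_cong) auto
      have ns: "Suc n \<notin> s" using s by auto
      have "w ?s n = w s n"
        unfolding w_def by (intro prod.cong) (auto simp: d)
      then have w1: "w ?s (Suc n) = w s n * (p * (1 - y s n))"
        by (simp add: w_def d y_def)
      have w2: "w s (Suc n) = w s n * ((1 - p) * (1 - y s n))"
        using ns by (simp add: w_def y_def)
      have y1: "y ?s (Suc n) = y s n * (1 - \<gamma> (Suc n))"
        by (simp add: y_def decay_Suc d)
      have y2: "y s (Suc n) = y s n"
        using ns by (simp add: y_def decay_Suc)
      have "(1 - y s n) powr T n \<le> (1 - y s n) *
          (p * (1 - y s n * (1 - \<gamma> (Suc n))) powr T (Suc n) + (1 - p) * (1 - y s n) powr T (Suc n))"
        unfolding TSuc[of n] using y \<gamma>[of "Suc n"] p T0 by (intro bernoulli_step_lower_bound) auto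
      from mult_left_mono[OF this w0[of s n]] show ?thesis
        unfolding w1 w2 y1 y2 by (simp add: algebra_simps)
    qed
    have "(\<Sum>s\<in>Pow {1..n}. w s n * (1 - y s n) powr T n)
        \<le> (\<Sum>s\<in>Pow (insert (Suc n) {1..n}). w s (Suc n) * (1 - y s (Suc n)) powr T (Suc n))"
      by (subst sum_Pow_insert) (auto intro!: sum_mono step[simplified])
    moreover have "insert (Suc n) {1..n} = {1..Suc n}" by auto
    ultimately show ?case using Suc by simp
  qed
  \<comment> \<open>The bases lie in the unit interval and \<open>T n\<close> is nonnegative, so
    dropping the powers can only enlarge the sum.\<close>
  also have "(\<Sum>s\<in>Pow {1..n}. w s n * (1 - y s n) powr T n) \<le> (\<Sum>s\<in>Pow {1..n}. w s n)"
    using y w0 T0 by (intro sum_mono mult_right_le_one_le powr_le1) (auto simp: less_imp_le)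
  finally show ?thesis by (simp add: T_def w_def)
qed

section \<open>Joint law of the uniform variables and of the pattern of \<open>B\<close>\<close>

text \<open>The empty \<open>J\<close> is included because the index set \<open>{1..n}\<close> is
  empty for \<open>n = 0\<close>.\<close>

lemma (in prob_space) prob_Ball_indep_vars:
  assumes "indep_vars N X I" "finite J" "J \<subseteq> I" "\<And>i. i \<in> J \<Longrightarrow> S i \<in> sets (N i)"
  shows "prob {\<omega>\<in>space M. \<forall>i\<in>J. X i \<omega> \<in> S i} = (\<Prod>i\<in>J. prob {\<omega>\<in>space M. X i \<omega> \<in> S i})"
proof (cases "J = {}")
  case False
  have "{\<omega>\<in>space M. \<forall>i\<in>J. X i \<omega> \<in> S i} = (\<Inter>i\<in>J. X i -` S i \<inter> space M)"
    using False by auto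
  moreover have "{\<omega>\<in>space M. X i \<omega> \<in> S i} = X i -` S i \<inter> space M" for i
    by auto
  ultimately show ?thesis
    using indep_varsD[OF assms(1) False assms(2,3), of S] assms(4) by simp
qed (simp add: prob_space)

context bandit_driver
begin

lemma U_measurable: "n \<ge> 1 \<Longrightarrow> U n \<in> borel_measurable M"
  using U_indep by (auto simp: indep_vars_def)

lemma prob_U_greater:
  assumes "n \<ge> 1" "0 \<le> c" "c \<le> 1"
  shows "prob {\<omega>\<in>space M. U n \<omega> \<in> {c<..}} = 1 - c"
proof -
  have "prob {\<omega>\<in>space M. U n \<omega> \<in> {c<..}} = measure (distr M borel (U n)) {c<..}"
    using U_measurable[OF assms(1)] by (subst measure_distr) (auto intro!: arg_cong[where f=prob])
  also have "\<dots> = measure lborel ({0..1} \<inter> {c<..}) / measure lborel {0..1::real}"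
    by (simp add: U_uniform[OF assms(1)])
  also have "{0..1} \<inter> {c<..} = {c<..1}" using assms by auto
  finally show ?thesis using assms by simp
qed

lemma prob_B_eq: "n \<ge> 1 \<Longrightarrow> prob (B n) = pB"
proof -
  assume n: "n \<ge> 1"
  let ?Z = "\<lambda>n \<omega>. (indicator (A n) \<omega> :: real, indicator (B n) \<omega> :: real)"
  have "prob (B k) = measure (distr M (borel \<Otimes>\<^sub>M borel) (?Z k)) (UNIV \<times> {1})" if "k \<ge> 1" for k
  proof -
    have "?Z k -` (UNIV \<times> {1}) \<inter> space M = B k"
      using sets.sets_into_space[OF B_events[OF that]] by (auto simp: indicator_def)
    then show ?thesis
      using A_events[OF that] B_events[OF that] by (subst measure_distr) auto
  qed
  from this[OF n] this[of 1] show ?thesis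
    using AB_identical[OF n] prob_B by simp
qed

lemma B_indicator_indep: "indep_vars (\<lambda>_. borel) (\<lambda>n \<omega>. indicator (B n) \<omega> :: real) {1..}"
  using indep_vars_compose2[OF AB_indep, of "\<lambda>_. snd" "\<lambda>_. borel"] by simp

lemma prob_B_pattern:
  "prob {\<omega>\<in>space M. \<forall>k\<in>{1..n}. \<omega> \<in> B k \<longleftrightarrow> k \<in> s} = (\<Prod>k=1..n. if k \<in> s then pB else 1 - pB)"
proof -
  \<comment> \<open>Occurrence or non-occurrence of \<open>B k\<close> is phrased as membership of
    its indicator in a Borel set, the form that the product rule takes.\<close>
  define S where "S k = (if k \<in> s then {1} else - {1::real})" for k :: nat
  have mem: "indicator (B k) \<omega> \<in> S k \<longleftrightarrow> (\<omega> \<in> B k \<longleftrightarrow> k \<in> s)" for k \<omega>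
    by (auto simp: S_def indicator_def)
  have "prob {\<omega>\<in>space M. \<omega> \<in> B k \<longleftrightarrow> k \<in> s} = (if k \<in> s then pB else 1 - pB)" if "k \<ge> 1" for k
  proof (cases "k \<in> s")
    case True
    have "{\<omega>\<in>space M. \<omega> \<in> B k} = B k"
      using sets.sets_into_space[OF B_events[OF that]] by auto
    then show ?thesis using True prob_B_eq[OF that] by simp
  next
    case False
    have "{\<omega>\<in>space M. \<omega> \<notin> B k} = space M - B k" by auto
    then show ?thesis using False prob_B_eq[OF that] prob_compl[OF B_events[OF that]] by simp
  qed
  moreover have "prob {\<omega>\<in>space M. \<forall>k\<in>{1..n}. indicator (B k) \<omega> \<in> S k}
      = (\<Prod>k=1..n. prob {\<omega>\<in>space M. indicator (B k) \<omega> \<in> S k})"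
    by (intro prob_Ball_indep_vars[OF B_indicator_indep]) (auto simp: S_def)
  ultimately show ?thesis
    by (simp add: mem)
qed

text \<open>With constant thresholds \<open>c k\<close> the event is the intersection of one about
  \<open>U\<close> and one about \<open>B\<close>. Independence between the two sequences and within
  each of them gives the product.\<close>

lemma prob_pattern:
  assumes "\<And>k. k \<in> {1..n} \<Longrightarrow> 0 \<le> c k \<and> c k \<le> 1"
  shows "prob {\<omega>\<in>space M. \<forall>k\<in>{1..n}. (\<omega> \<in> B k \<longleftrightarrow> k \<in> s) \<and> c k < U k \<omega>}
    = (\<Prod>k=1..n. (if k \<in> s then pB else 1 - pB) * (1 - c k))"
proof -
  let ?VU = "vimage_algebra (space M) (\<lambda>\<omega>. \<lambda>n\<in>{1..}. U n \<omega>) (PiM {1..} (\<lambda>_. borel))"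
  let ?VB = "vimage_algebra (space M)
    (\<lambda>\<omega>. \<lambda>n\<in>{1..}. (indicator (A n) \<omega> :: real, indicator (B n) \<omega> :: real))
        (PiM {1..} (\<lambda>_. borel \<Otimes>\<^sub>M borel))"
  let ?EU = "{\<omega>\<in>space M. \<forall>k\<in>{1..n}. U k \<omega> \<in> {c k<..}}"
  let ?EB = "{\<omega>\<in>space M. \<forall>k\<in>{1..n}. \<omega> \<in> B k \<longleftrightarrow> k \<in> s}"
  \<comment> \<open>\<open>F\<close> and \<open>G\<close> are cylinder sets whose preimages are the
    two events. This places each event in the generated \<sigma>-algebra to which the independence
    assumption refers.\<close>
  define F where "F = {f\<in>space (PiM {1::nat..} (\<lambda>_. borel)). \<forall>k\<in>{1..n}. f k \<in> {c k<..}}"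
  define G where "G = {f\<in>space (PiM {1::nat..} (\<lambda>_. borel \<Otimes>\<^sub>M borel)).
      \<forall>k\<in>{1..n}. (snd (f k :: real \<times> real) = 1 \<longleftrightarrow> k \<in> s)}"
  have "F \<in> sets (PiM {1::nat..} (\<lambda>_. borel))"
    unfolding F_def by measurable
  from in_vimage_algebra[OF this, of "\<lambda>\<omega>. \<lambda>n\<in>{1..}. U n \<omega>" "space M"]
  have EU: "?EU \<in> sets ?VU"
    by (rule back_subst[where P="\<lambda>S. S \<in> _"]) (auto simp: F_def space_PiM)
  have "G \<in> sets (PiM {1::nat..} (\<lambda>_. borel \<Otimes>\<^sub>M borel))"
    unfolding G_def by measurable
  from in_vimage_algebra[OF this,
      of "\<lambda>\<omega>. \<lambda>n\<in>{1..}. (indicator (A n) \<omega> :: real, indicator (B n) \<omega> :: real)" "space M"]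
  have EB: "?EB \<in> sets ?VB"
    by (rule back_subst[where P="\<lambda>S. S \<in> _"])
      (auto simp: G_def space_PiM space_pair_measure indicator_def split: if_splits)
  have "{\<omega>\<in>space M. \<forall>k\<in>{1..n}. (\<omega> \<in> B k \<longleftrightarrow> k \<in> s) \<and> c k < U k \<omega>} = ?EU \<inter> ?EB"
    by auto
  then have "prob {\<omega>\<in>space M. \<forall>k\<in>{1..n}. (\<omega> \<in> B k \<longleftrightarrow> k \<in> s) \<and> c k < U k \<omega>} = prob ?EU * prob ?EB"
    using indep_setD[OF U_AB_indep EU EB] by simp
  also have "prob ?EU = (\<Prod>k=1..n. prob {\<omega>\<in>space M. U k \<omega> \<in> {c k<..}})"
    by (intro prob_Ball_indep_vars[OF U_indep]) auto
  also have "\<dots> = (\<Prod>k=1..n. 1 - c k)"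
    using assms prob_U_greater by (intro prod.cong) auto
  also have "prob ?EB = (\<Prod>k=1..n. if k \<in> s then pB else 1 - pB)"
    by (rule prob_B_pattern)
  finally show ?thesis by (simp add: prod.distrib mult.commute)
qed


section \<open>Survival events and the path of the algorithm\<close>

text \<open>\<open>U k\<close> is compared with the value before step \<open>k\<close>, hence the
  index \<open>k - 1\<close>. Writing that value as a product makes the thresholds depend on the
  events \<open>B\<close> alone.\<close>

definition survival :: "(nat \<Rightarrow> real) \<Rightarrow> real \<Rightarrow> nat \<Rightarrow> 'a set" where
  "survival \<gamma> x n =
     {\<omega>\<in>space M. \<forall>k\<in>{1..n}. x * decay \<gamma> {j. \<omega> \<in> B j} (k - 1) < U k \<omega>}"

lemma B_indicator_measurable: "n \<ge> 1 \<Longrightarrow> indicator (B n) \<in> borel_measurable M"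
  using B_events by simp

lemma decay_B_measurable: "(\<lambda>\<omega>. decay \<gamma> {j. \<omega> \<in> B j} n) \<in> borel_measurable M"
proof -
  have "(\<lambda>\<omega>. decay \<gamma> {j. \<omega> \<in> B j} n) = (\<lambda>\<omega>. \<Prod>k=1..n. 1 - \<gamma> k * indicator (B k) \<omega>)"
    by (simp add: decay_def indicator_def)
  then show ?thesis
    using B_indicator_measurable by (auto intro!: borel_measurable_prod borel_measurable_diff borel_measurable_times)
qed

lemma survival_events: "survival \<gamma> x n \<in> events"
  unfolding survival_def
  using decay_B_measurable U_measurable
  by (intro sets.sets_Collect_finite_All borel_measurable_less borel_measurable_times) auto

lemma B_pattern_events: "{\<omega>\<in>space M. \<forall>k\<in>{1..n}. \<omega> \<in> B k \<longleftrightarrow> k \<in> s} \<in> events"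
proof (intro sets.sets_Collect_finite_All)
  fix k assume "k \<in> {1..n}"
  then have [measurable]: "B k \<in> events" using B_events by simp
  show "{\<omega>\<in>space M. \<omega> \<in> B k \<longleftrightarrow> k \<in> s} \<in> events" by measurable
qed simp

text \<open>The thresholds are random only through \<open>B\<close>, so they become constants on
  each piece of the partition by patterns, and \<open>prob_pattern\<close> applies there.\<close>

lemma prob_survival:
  assumes \<gamma>: "\<And>k. 1 \<le> k \<Longrightarrow> 0 < \<gamma> k \<and> \<gamma> k < 1" and x: "0 \<le> x" "x < 1"
  shows "prob (survival \<gamma> x n)
    = (\<Sum>s\<in>Pow {1..n}. \<Prod>k=1..n. (if k \<in> s then pB else 1 - pB) * (1 - x * decay \<gamma> s (k - 1)))"
proof -
  define E where "E s = survival \<gamma> x n \<inter> {\<omega>\<in>space M. \<forall>k\<in>{1..n}. \<omega> \<in> B k \<longleftrightarrow> k \<in> s}" for s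
  have "\<omega> \<in> E ({k. \<omega> \<in> B k} \<inter> {1..n})" if "\<omega> \<in> survival \<gamma> x n" for \<omega>
    using that by (auto simp: E_def survival_def)
  then have "survival \<gamma> x n \<subseteq> (\<Union>s\<in>Pow {1..n}. E s)"
    by blast
  moreover have "(\<Union>s\<in>Pow {1..n}. E s) \<subseteq> survival \<gamma> x n"
    by (auto simp: E_def)
  ultimately have "survival \<gamma> x n = (\<Union>s\<in>Pow {1..n}. E s)"
    by (rule equalityI)
  moreover have "s = {k. \<omega> \<in> B k} \<inter> {1..n}" if "\<omega> \<in> E s" "s \<in> Pow {1..n}" for \<omega> s
    using that by (auto simp: E_def)
  then have "disjoint_family_on E (Pow {1..n})"
    unfolding disjoint_family_on_def disjoint_iff by metis
  moreover have "E s \<in> events" for s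
    unfolding E_def using survival_events B_pattern_events by blast
  ultimately have "prob (survival \<gamma> x n) = (\<Sum>s\<in>Pow {1..n}. prob (E s))"
    using finite_measure_finite_Union[of "Pow {1..n}" E] by auto
  also have "\<dots> = (\<Sum>s\<in>Pow {1..n}. \<Prod>k=1..n. (if k \<in> s then pB else 1 - pB) * (1 - x * decay \<gamma> s (k - 1)))"
  proof (rule sum.cong[OF refl])
    fix s assume "s \<in> Pow {1..n}"
    have "decay \<gamma> {j. \<omega> \<in> B j} (k - 1) = decay \<gamma> s (k - 1)"
      if "k \<in> {1..n}" "\<forall>k\<in>{1..n}. \<omega> \<in> B k \<longleftrightarrow> k \<in> s" for k \<omega>
      using that by (intro decay_cong) auto
    then have "E s = {\<omega>\<in>space M. \<forall>k\<in>{1..n}. (\<omega> \<in> B k \<longleftrightarrow> k \<in> s) \<and> x * decay \<gamma> s (k - 1) < U k \<omega>}"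
      unfolding E_def survival_def by auto
    moreover have "0 \<le> x * decay \<gamma> s j \<and> x * decay \<gamma> s j \<le> 1" for j
      using decay_bounds[OF \<gamma>, where s=s and n=j] x by (auto intro: mult_le_one)
    ultimately show "prob (E s) = (\<Prod>k=1..n. (if k \<in> s then pB else 1 - pB) * (1 - x * decay \<gamma> s (k - 1)))"
      using prob_pattern by simp
  qed
  finally show ?thesis .
qed

text \<open>Survival rules out every upward move, so step \<open>k\<close> multiplies the value by
  \<open>1 - \<gamma> k\<close> if \<open>B k\<close> occurs and by 1 otherwise.\<close>

lemma bandit_eq_decay:
  assumes "\<omega> \<in> survival \<gamma> x n"
  shows "bandit U A B \<gamma> x n \<omega> = x * decay \<gamma> {j. \<omega> \<in> B j} n"
  using assms
proof (induction n)
  case (Suc n)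
  then have *: "\<omega> \<in> survival \<gamma> x n" "x * decay \<gamma> {j. \<omega> \<in> B j} n < U (Suc n) \<omega>"
    using bspec[of "{1..Suc n}" "\<lambda>k. x * decay \<gamma> {j. \<omega> \<in> B j} (k - 1) < U k \<omega>" "Suc n"]
    by (auto simp: survival_def)
  show ?case
    using Suc.IH[OF *(1)] *(2) by (simp add: decay_Suc indicator_def algebra_simps)
qed simp

lemma bandit_measurable: "bandit U A B \<gamma> x n \<in> borel_measurable M"
proof (induction n)
  case (Suc n)
  note [measurable] = Suc U_measurable[of "Suc n", simplified] A_events[of "Suc n", simplified]
    B_events[of "Suc n", simplified]
  \<comment> \<open>The sets inside the indicators depend on the sample point through the current
    value; conditionals turn the step into a measurable expression.\<close>
  have "bandit U A B \<gamma> x (Suc n) = (\<lambda>\<omega>. bandit U A B \<gamma> x n \<omega> + \<gamma> (Suc n) *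
      ((1 - bandit U A B \<gamma> x n \<omega>) * (if U (Suc n) \<omega> \<le> bandit U A B \<gamma> x n \<omega> then indicator (A (Suc n)) \<omega> else 0)
     - bandit U A B \<gamma> x n \<omega> * (if U (Suc n) \<omega> > bandit U A B \<gamma> x n \<omega> then indicator (B (Suc n)) \<omega> else 0)))"
    by (auto simp: fun_eq_iff Let_def indicator_def)
  also have "\<dots> \<in> borel_measurable M" by measurable
  finally show ?case .
qed (simp cong: measurable_cong)

lemma limit_zero_events: "{\<omega>\<in>space M. (\<lambda>n. bandit U A B \<gamma> x n \<omega>) \<longlonglongrightarrow> 0} \<in> events"
proof -
  note [measurable] = bandit_measurable
  show ?thesis by measurable
qed

section \<open>Almost sure decay and convergence to zero\<close>

lemma expectation_decay:
  "expectation (\<lambda>\<omega>. decay \<gamma> {j. \<omega> \<in> B j} n) = mean_decay \<gamma> pB n"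
proof -
  have ind: "indep_vars (\<lambda>_. borel) (\<lambda>k \<omega>. 1 - \<gamma> k * indicator (B k) \<omega>) {1..n}"
    using indep_vars_subset[OF indep_vars_compose2[OF B_indicator_indep,
      of "\<lambda>k z. 1 - \<gamma> k * z" "\<lambda>_. borel"], of "{1..n}"] by auto
  have int: "integrable M (\<lambda>\<omega>. 1 - \<gamma> k * indicator (B k) \<omega>)" if "k \<in> {1..n}" for k
    using that B_events[of k] by (auto simp: less_top[symmetric])
  have "expectation (\<lambda>\<omega>. \<Prod>k=1..n. 1 - \<gamma> k * indicator (B k) \<omega>)
      = (\<Prod>k=1..n. expectation (\<lambda>\<omega>. 1 - \<gamma> k * indicator (B k) \<omega>))"
    by (intro indep_vars_lebesgue_integral ind int) auto
  also have "\<dots> = mean_decay \<gamma> pB n"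
    unfolding mean_decay_def
    using B_events prob_B_eq by (intro prod.cong) (auto simp: prob_space less_top[symmetric] mult.commute)
  finally show ?thesis by (simp add: decay_def indicator_def)
qed

text \<open>The products decrease to a limit \<open>L \<ge> 0\<close> whose mean is below every
  \<open>mean_decay \<gamma> pB n\<close>, hence zero. A nonnegative variable of mean zero vanishes
  almost surely.\<close>

lemma AE_decay_tendsto_0:
  assumes \<gamma>: "\<And>k. 1 \<le> k \<Longrightarrow> 0 < \<gamma> k \<and> \<gamma> k < 1" and lim: "mean_decay \<gamma> pB \<longlonglongrightarrow> 0"
  shows "AE \<omega> in M. (\<lambda>n. decay \<gamma> {j. \<omega> \<in> B j} n) \<longlonglongrightarrow> 0"
proof -
  define L where "L \<omega> = (INF n. decay \<gamma> {j. \<omega> \<in> B j} n)" for \<omega>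
  have b: "0 \<le> decay \<gamma> s n" "decay \<gamma> s n \<le> 1" for s n
    by (rule decay_bounds, rule \<gamma>, assumption)+
  have bdd: "bdd_below (range (decay \<gamma> s))" for s
    using b(1) by (intro bdd_belowI2[where m=0]) auto
  have L: "(\<lambda>n. decay \<gamma> {j. \<omega> \<in> B j} n) \<longlonglongrightarrow> L \<omega>" for \<omega>
    unfolding L_def by (intro LIMSEQ_decseq_INF bdd decay_decseq \<gamma>)
  have L0: "0 \<le> L \<omega>" for \<omega>
    unfolding L_def using b(1) by (intro cINF_greatest) auto
  have Ln: "L \<omega> \<le> decay \<gamma> {j. \<omega> \<in> B j} n" for \<omega> n
    unfolding L_def by (intro cINF_lower bdd) auto
  have Lm: "L \<in> borel_measurable M"
    by (rule borel_measurable_LIMSEQ_real[OF L decay_B_measurable])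
  have dint: "integrable M (\<lambda>\<omega>. decay \<gamma> {j. \<omega> \<in> B j} n)" for n
    using b by (intro integrable_const_bound[where B=1] decay_B_measurable) auto
  have L1: "L \<omega> \<le> 1" for \<omega> using Ln[of \<omega> 0] by simp
  have Lint: "integrable M L"
    using L0 L1 by (intro integrable_const_bound[where B=1] Lm) auto
  have "expectation L \<le> mean_decay \<gamma> pB n" for n
    unfolding expectation_decay[symmetric] using Ln by (intro integral_mono Lint dint) auto
  then have "expectation L \<le> 0"
    using lim by (intro LIMSEQ_le_const) auto
  moreover have "0 \<le> expectation L" using L0 by simp
  ultimately have "AE \<omega> in M. L \<omega> = 0"
    using integral_nonneg_eq_0_iff_AE[OF Lint] L0 by simp
  then show ?thesis
  proof (rule AE_mp, intro AE_I2 impI)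
    fix \<omega> assume "L \<omega> = 0"
    with L[of \<omega>] show "(\<lambda>n. decay \<gamma> {j. \<omega> \<in> B j} n) \<longlonglongrightarrow> 0" by simp
  qed
qed

text \<open>The bound is uniform in \<open>n\<close>, so it passes to survival at all times by
  continuity from above. There the path is \<open>x\<close> times a product that tends to zero
  almost surely.\<close>

theorem prob_tendsto_0_lower_bound:
  assumes \<gamma>: "\<And>k. 1 \<le> k \<Longrightarrow> 0 < \<gamma> k \<and> \<gamma> k < 1" and x: "0 \<le> x" "x < 1"
    and summ: "summable (mean_decay \<gamma> pB)"
  shows "(1 - x) powr (\<Sum>n. mean_decay \<gamma> pB n)
    \<le> prob {\<omega>\<in>space M. (\<lambda>n. bandit U A B \<gamma> x n \<omega>) \<longlonglongrightarrow> 0}"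
proof -
  have p: "0 \<le> pB" "pB \<le> 1" using prob_B by auto
  have "(\<lambda>n. prob (survival \<gamma> x n)) \<longlonglongrightarrow> prob (\<Inter>n. survival \<gamma> x n)"
    using survival_events by (intro finite_Lim_measure_decseq) (auto simp: decseq_Suc_iff survival_def)
  moreover have "(1 - x) powr (\<Sum>n. mean_decay \<gamma> pB n) \<le> prob (survival \<gamma> x n)" for n
    by (rule order_trans[OF sum_pattern_lower_bound[OF _ p x summ] eq_refl[OF prob_survival[symmetric]]])
      (use \<gamma> x in auto)
  ultimately have "(1 - x) powr (\<Sum>n. mean_decay \<gamma> pB n) \<le> prob (\<Inter>n. survival \<gamma> x n)"
    by (intro LIMSEQ_le_const) auto
  also have "\<dots> \<le> prob {\<omega>\<in>space M. (\<lambda>n. bandit U A B \<gamma> x n \<omega>) \<longlonglongrightarrow> 0}"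
  proof (rule finite_measure_mono_AE[OF _ limit_zero_events])
    have "AE \<omega> in M. (\<lambda>n. decay \<gamma> {j. \<omega> \<in> B j} n) \<longlonglongrightarrow> 0"
      by (intro AE_decay_tendsto_0 \<gamma> summable_LIMSEQ_zero summ)
    then show "AE \<omega> in M. \<omega> \<in> (\<Inter>n. survival \<gamma> x n) \<longrightarrow>
        \<omega> \<in> {\<omega>\<in>space M. (\<lambda>n. bandit U A B \<gamma> x n \<omega>) \<longlonglongrightarrow> 0}"
    proof (rule AE_mp, intro AE_I2 impI)
      fix \<omega> assume "\<omega> \<in> space M" "(\<lambda>n. decay \<gamma> {j. \<omega> \<in> B j} n) \<longlonglongrightarrow> 0" "\<omega> \<in> (\<Inter>n. survival \<gamma> x n)"
      then show "\<omega> \<in> {\<omega>\<in>space M. (\<lambda>n. bandit U A B \<gamma> x n \<omega>) \<longlonglongrightarrow> 0}"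
        using bandit_eq_decay[of \<omega> \<gamma> x] by (auto intro!: tendsto_mult_right_zero)
    qed
  qed
  finally show ?thesis .
qed

end

text \<open>This identifies the quantity in the first two claims with the probability that defines
  fallibility.\<close>

lemma limit_zero_prob_eq:
  "limit_zero_prob M U A B \<gamma> x = measure M {\<omega>\<in>space M. (\<lambda>n. bandit U A B \<gamma> x n \<omega>) \<longlonglongrightarrow> 0}"
proof -
  have "convergent f \<and> lim f = 0 \<longleftrightarrow> f \<longlonglongrightarrow> 0" for f :: "nat \<Rightarrow> real"
    using convergent_LIMSEQ_iff[of f] convergentI[of f 0] limI[of f 0] by auto
  then show ?thesis
    by (simp add: limit_zero_prob_def bandit_limit_def)
qed

section \<open>Power steps: divergence of the steps and summability of the means\<close>

lemma power_step_bounds: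
  assumes "0 < C" "0 < \<alpha>" "1 \<le> n"
  shows "0 < power_step C \<alpha> n" "power_step C \<alpha> n < 1"
proof -
  have "0 < C / (real n + C)" "C / (real n + C) < 1"
    using assms by auto
  then show "0 < power_step C \<alpha> n" "power_step C \<alpha> n < 1"
    unfolding power_step_def using assms(2) powr_less_mono2[of \<alpha> "C / (real n + C)" 1] by auto
qed

text \<open>A discrete integral comparison: the increments of the logarithm are bounded by
  \<open>ln (1 + u) \<le> u\<close> with \<open>u = 1 / (real n + 1 + C)\<close>.\<close>

lemma sum_harmonic_lower_bound:
  assumes "0 < C"
  shows "C * ln ((real n + 1 + C) / (1 + C)) \<le> (\<Sum>k=1..n. C / (real k + C))"
proof (induction n)
  case (Suc n)
  have "ln ((real n + 2 + C) / (real n + 1 + C)) = ln (1 + 1 / (real n + 1 + C))"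
    using assms by (intro arg_cong[where f=ln]) (simp add: divide_simps)
  also have "\<dots> \<le> 1 / (real n + 1 + C)"
    using assms by (intro ln_add_one_self_le_self) auto
  finally have "C * ln ((real n + 2 + C) / (real n + 1 + C)) \<le> C / (real n + 1 + C)"
    using assms mult_left_mono[of _ _ C] by fastforce
  then show ?case
    using Suc assms by (simp add: ln_div algebra_simps)
qed (use assms in simp)

lemma power_step_steps:
  assumes "0 < C" "0 < \<alpha>" "\<alpha> \<le> 1"
  shows "bandit_steps (power_step C \<alpha>)"
proof -
  have "filterlim (\<lambda>n. C * ln ((real n + 1 + C) / (1 + C))) at_top sequentially"
    using assms(1) by real_asymp
  moreover have "C * ln ((real n + 1 + C) / (1 + C)) \<le> (\<Sum>k=1..n. power_step C \<alpha> k)" for n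
  proof (rule order_trans[OF sum_harmonic_lower_bound[OF assms(1)] sum_mono])
    fix k assume "k \<in> {1..n}"
    \<comment> \<open>The base is at most 1, so lowering the exponent from 1 to
      \<open>\<alpha>\<close> increases the power; the harmonic case is the smallest.\<close>
    have "(C / (real k + C)) powr 1 \<le> (C / (real k + C)) powr \<alpha>"
      using assms by (intro powr_mono') auto
    then show "C / (real k + C) \<le> power_step C \<alpha> k"
      using assms by (simp add: power_step_def)
  qed
  ultimately show ?thesis
    unfolding bandit_steps_def using power_step_bounds[OF assms(1,2)]
    by (auto intro: filterlim_at_top_mono)
qed

text \<open>\<open>1 - u \<le> exp (- u)\<close> is applied to each factor; the hypothesis keeps the
  factors nonnegative, so that the inequalities may be multiplied.\<close>

lemma mean_decay_le_exp:
  assumes "\<And>k. 1 \<le> k \<Longrightarrow> p * \<gamma> k \<le> 1"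
  shows "mean_decay \<gamma> p n \<le> exp (- p * (\<Sum>k=1..n. \<gamma> k))"
proof -
  have "mean_decay \<gamma> p n \<le> (\<Prod>k=1..n. exp (- (p * \<gamma> k)))"
    unfolding mean_decay_def
  proof (rule prod_mono)
    fix k assume "k \<in> {1..n}"
    then show "0 \<le> 1 - p * \<gamma> k \<and> 1 - p * \<gamma> k \<le> exp (- (p * \<gamma> k))"
      using assms[of k] exp_ge_add_one_self[of "- (p * \<gamma> k)"] by auto
  qed
  also have "\<dots> = exp (- p * (\<Sum>k=1..n. \<gamma> k))"
    by (simp add: exp_sum[symmetric] sum_negf sum_distrib_left)
  finally show ?thesis .
qed

text \<open>For \<open>\<alpha> < 1\<close> the sum of the steps grows at least like a multiple of
  \<open>n powr (1 - \<alpha>)\<close>, so the means decay as a stretched exponential. For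
  \<open>\<alpha> = 1\<close> it grows like \<open>C * ln n\<close>, and the means are at most of
  order \<open>n powr (- (p * C))\<close>.\<close>

lemma summable_mean_decay_power_step:
  assumes C: "0 < C" and \<alpha>: "0 < \<alpha>" and p: "0 < p" "p \<le> 1"
    and cases: "\<alpha> < 1 \<or> \<alpha> = 1 \<and> C > 1 / p"
  shows "summable (mean_decay (power_step C \<alpha>) p)"
proof -
  let ?P = "mean_decay (power_step C \<alpha>) p"
  have le: "p * power_step C \<alpha> k \<le> 1" if "1 \<le> k" for k
    using power_step_bounds[OF C \<alpha> that] p by (intro mult_le_one) auto
  have pos: "0 < ?P n" for n
    using power_step_bounds[OF C \<alpha>] p by (intro mean_decay_pos) auto
  have exp_bound: "?P n \<le> exp (- p * (\<Sum>k=1..n. power_step C \<alpha> k))" for n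
    by (intro mean_decay_le_exp le)
  show ?thesis
  proof (cases "\<alpha> < 1")
    case True
    have bound: "?P n \<le> exp (- p * (real n * (C / (real n + C)) powr \<alpha>))" for n
    proof -
      \<comment> \<open>The steps decrease, so each of the first \<open>n\<close> is at least the
        last one.\<close>
      have "(C / (real n + C)) powr \<alpha> \<le> power_step C \<alpha> k" if "k \<in> {1..n}" for k
        unfolding power_step_def using that C \<alpha> by (intro powr_mono2) (auto simp: divide_simps)
      then have "(\<Sum>k=1..n. (C / (real n + C)) powr \<alpha>) \<le> (\<Sum>k=1..n. power_step C \<alpha> k)"
        by (rule sum_mono)
      then have "exp (- p * (\<Sum>k=1..n. power_step C \<alpha> k)) \<le> exp (- p * (real n * (C / (real n + C)) powr \<alpha>))"
        using p by simp
      with exp_bound show ?thesis by (rule order_trans)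
    qed
    have "(\<lambda>n. exp (- p * (real n * (C / (real n + C)) powr \<alpha>))) \<in> O(\<lambda>n. 1 / real n ^ 2)"
      using True C \<alpha> p by real_asymp
    then have "summable (\<lambda>n. exp (- p * (real n * (C / (real n + C)) powr \<alpha>)))"
      by (rule summable_comparison_test_bigo[rotated])
        (use inverse_power_summable[of 2, where ?'a=real] in \<open>simp add: inverse_eq_divide\<close>)
    then show ?thesis
      by (rule summable_comparison_test'[where N=0]) (use bound abs_of_pos[OF pos] in simp)
  next
    case False
    with cases have \<alpha>1: "\<alpha> = 1" and pC: "p * C > 1"
      using p by (simp_all add: pos_divide_less_eq mult.commute)
    have bound: "?P n \<le> exp (- p * (C * ln ((real n + 1 + C) / (1 + C))))" for n
    proof -
      have "C * ln ((real n + 1 + C) / (1 + C)) \<le> (\<Sum>k=1..n. power_step C \<alpha> k)"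
        using sum_harmonic_lower_bound[OF C, of n] C \<alpha>1 by (simp add: power_step_def)
      then have "exp (- p * (\<Sum>k=1..n. power_step C \<alpha> k)) \<le> exp (- p * (C * ln ((real n + 1 + C) / (1 + C))))"
        using p by simp
      with exp_bound show ?thesis by (rule order_trans)
    qed
    \<comment> \<open>The condition \<open>C > 1 / p\<close> is what makes this power of
      \<open>n\<close> summable.\<close>
    have "(\<lambda>n. exp (- p * (C * ln ((real n + 1 + C) / (1 + C))))) \<in> O(\<lambda>n. real n powr (- (p * C)))"
      using C p by real_asymp
    then have "summable (\<lambda>n. exp (- p * (C * ln ((real n + 1 + C) / (1 + C)))))"
      by (rule summable_comparison_test_bigo[rotated])
        (use pC in \<open>simp add: summable_real_powr_iff\<close>)
    then show ?thesis
      by (rule summable_comparison_test'[where N=0]) (use bound abs_of_pos[OF pos] in simp)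
  qed
qed

section \<open>Constant steps and the three claims\<close>

theorem corollary1:
  fixes M :: "'a measure" and U :: "nat \<Rightarrow> 'a \<Rightarrow> real" and A B :: "nat \<Rightarrow> 'a set"
    and pA pB :: real
  assumes "bandit_driver M U A B pA pB"
    and "0 \<le> pA" "pA \<le> 1" and "0 < pB" "pB \<le> 1"
  shows
    "(\<forall>g x. 0 < g \<and> g < 1 \<and> 0 < x \<and> x < 1 \<longrightarrow>
        limit_zero_prob M U A B (\<lambda>_. g) x \<ge> (1 - x) powr (1 / (pB * g)) \<and>
        (1 - x) powr (1 / (pB * g)) > 0)
   \<and> (\<forall>\<alpha> C. 0 < \<alpha> \<and> \<alpha> \<le> 1 \<and> 0 < C \<longrightarrow>
        bandit_steps (power_step C \<alpha>) \<and>
        (\<alpha> < 1 \<or> (\<alpha> = 1 \<and> C > 1 / pB) \<longrightarrow>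
          (\<forall>x. 0 \<le> x \<and> x < 1 \<longrightarrow> limit_zero_prob M U A B (power_step C \<alpha>) x > 0)))
   \<and> (pB < pA \<longrightarrow>
        (\<forall>x. 0 \<le> x \<and> x < 1 \<longrightarrow>
          (\<forall>g. 0 < g \<and> g < 1 \<longrightarrow> fallible_from M U A B (\<lambda>_. g) x) \<and>
          (\<forall>\<alpha> C. 0 < \<alpha> \<and> \<alpha> \<le> 1 \<and> 0 < C \<and> (\<alpha> < 1 \<or> (\<alpha> = 1 \<and> C > 1 / pB)) \<longrightarrow>
             fallible_from M U A B (power_step C \<alpha>) x)))"
proof -
  interpret bandit_driver M U A B pA pB by fact
  note p = \<open>0 < pB\<close> \<open>pB \<le> 1\<close>
  \<comment> \<open>The start \<open>x = 0\<close> is allowed here because fallibility is claimed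
    for it as well.\<close>
  have const: "(1 - x) powr (1 / (pB * g)) \<le> measure M {\<omega>\<in>space M. (\<lambda>n. bandit U A B (\<lambda>_. g) x n \<omega>) \<longlonglongrightarrow> 0}"
    if "0 < g" "g < 1" "0 \<le> x" "x < 1" for g x
  proof -
    have "0 < pB * g" using p that by simp
    moreover have "pB * g < 1"
      using p that mult_left_le_one_le[of g pB] by linarith
    \<comment> \<open>For a constant step the means are the powers of \<open>1 - pB * g\<close>, so
      the exponent of the general bound is a geometric series with sum
      \<open>1 / (pB * g)\<close>.\<close>
    ultimately have "(\<lambda>n. (1 - pB * g) ^ n) sums (1 / (1 - (1 - pB * g)))"
      by (intro geometric_sums) auto
    moreover have "mean_decay (\<lambda>_. g) pB = (\<lambda>n. (1 - pB * g) ^ n)"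
      by (simp add: fun_eq_iff mean_decay_def)
    ultimately show ?thesis
      using prob_tendsto_0_lower_bound[of "\<lambda>_. g" x] that by (simp add: sums_iff)
  qed
  have const_pos: "0 < measure M {\<omega>\<in>space M. (\<lambda>n. bandit U A B (\<lambda>_. g) x n \<omega>) \<longlonglongrightarrow> 0}"
    if "0 < g" "g < 1" "0 \<le> x" "x < 1" for g x
    using that by (intro less_le_trans[OF _ const]) auto
  have power: "0 < measure M {\<omega>\<in>space M. (\<lambda>n. bandit U A B (power_step C \<alpha>) x n \<omega>) \<longlonglongrightarrow> 0}"
    if "0 < \<alpha>" "0 < C" "\<alpha> < 1 \<or> \<alpha> = 1 \<and> C > 1 / pB" "0 \<le> x" "x < 1" for C \<alpha> x
    using that p
    by (intro less_le_trans[OF _ prob_tendsto_0_lower_bound] summable_mean_decay_power_step)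
      (auto simp: power_step_bounds)
  show ?thesis
    unfolding limit_zero_prob_eq fallible_from_def
    by (auto intro: const const_pos power power_step_steps)
qed

end
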